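(* Let $d=d_n$ be a sequence of positive integers such that $\frac{d_n}{\log n}\to\infty$. For each $n$, let $G_n$ be a $d_n$-regular graph of order $n$. Then the size of a maximum matching in $G_n$ is $\left(\frac12-o(1)\right)n$ as $n\to\infty$.
   Context: Graphs are finite and simple; the order of a graph is its number of vertices, and the size of a matching is its number of edges. It is assumed that $d_n n$ is even (so when $d$ is odd the limit is taken over even values of $n$). $\log$ is the natural logarithm, and $o(1)$ denotes a quantity tending to $0$ as $n\to\infty$. *)

theory Defs
  imports Complex_Main
begin

type_synonym 'a ugraph = "'a set \<times> 'a set set"

definition verts :: "'a ugraph \<Rightarrow> 'a set" where
  "verts G = fst G"

definition edges :: "'a ugraph \<Rightarrow> 'a set set" where
  "edges G = snd G"

definition simple_graph :: "'a ugraph \<Rightarrow> bool" where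
  "simple_graph G \<longleftrightarrow>
     finite (verts G) \<and> (\<forall>e\<in>edges G. e \<subseteq> verts G \<and> card e = 2)"

definition graph_order :: "'a ugraph \<Rightarrow> nat" where
  "graph_order G = card (verts G)"

definition degree :: "'a ugraph \<Rightarrow> 'a \<Rightarrow> nat" where
  "degree G v = card {e \<in> edges G. v \<in> e}"

definition regular_graph :: "nat \<Rightarrow> 'a ugraph \<Rightarrow> bool" where
  "regular_graph k G \<longleftrightarrow> simple_graph G \<and> (\<forall>v\<in>verts G. degree G v = k)"

definition matching :: "'a ugraph \<Rightarrow> 'a set set \<Rightarrow> bool" where
  "matching G M \<longleftrightarrow> M \<subseteq> edges G \<and> pairwise disjnt M"

text \<open>The set below is finite and contains 0 (from the empty matching) whenever
  \<open>G\<close> is a simple graph, so the maximum is attained.\<close>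

definition max_matching_size :: "'a ugraph \<Rightarrow> nat" where
  "max_matching_size G = Max (card ` {M. matching G M})"

text \<open>A \<open>d n\<close>-regular graph of order \<open>n\<close> can only exist if \<open>d n * n\<close> is even, so a sequence
  of such graphs is indexed by the following set. It contains every positive even \<open>n\<close>, hence is infinite;
  if every \<open>d n\<close> is odd, it is exactly the set of positive even numbers.\<close>

definition admissible :: "(nat \<Rightarrow> nat) \<Rightarrow> nat set" where
  "admissible d = {n. 0 < n \<and> even (d n * n)}"

end

theory Submission
  imports Defs
begin

text \<open>
  A \<open>d\<close>-regular graph on \<open>n\<close> vertices has a maximum matching missing at most \<open>n / (d + 1)\<close>
  vertices, and \<open>d\<^sub>n \<rightarrow> \<infinity>\<close>. The bound comes from the Tutte--Berge formula without its parity
  information: there are a set \<open>S\<close> and a partition of the remaining vertices into classes with no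
  edges between them, such that some matching misses at most (number of classes) \<open>- |S|\<close> vertices.
  In a \<open>d\<close>-regular graph a class \<open>C\<close> with at most \<open>d\<close> vertices sends at least
  \<open>|C| (d + 1 - |C|) \<ge> d\<close> edges to \<open>S\<close>, so there are at most \<open>|S|\<close> of those, and there are at most
  \<open>n / (d + 1)\<close> larger classes.
\<close>

section \<open>Matchings\<close>

lemma finite_edges: "simple_graph G \<Longrightarrow> finite (edges G)"
  unfolding simple_graph_def by (meson PowI finite_Pow_iff finite_subset subsetI)

lemma finite_matching: "\<lbrakk>simple_graph G; matching G M\<rbrakk> \<Longrightarrow> finite M"
  unfolding matching_def using finite_edges finite_subset by blast

lemma finite_matchings: "simple_graph G \<Longrightarrow> finite {M. matching G M}"
  by (rule finite_subset[of _ "Pow (edges G)"]) (auto simp: matching_def finite_edges)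

lemma Union_matching_subset: "\<lbrakk>simple_graph G; matching G M\<rbrakk> \<Longrightarrow> \<Union>M \<subseteq> verts G"
  unfolding matching_def simple_graph_def by blast

lemma card_Union_matching:
  assumes "simple_graph G" "matching G M"
  shows "card (\<Union>M) = 2 * card M"
proof -
  have card2: "card e = 2" if "e \<in> M" for e
    using assms that by (auto simp: matching_def simple_graph_def)
  have "card (\<Union>M) = sum card M"
  proof (rule card_Union_disjoint)
    show "pairwise disjnt M" using assms(2) by (simp add: matching_def)
    show "finite e" if "e \<in> M" for e
      using card2[OF that] by (metis card.infinite zero_neq_numeral)
  qed
  then show ?thesis by (simp add: card2)
qed

lemma matching_empty: "matching G {}"
  by (simp add: matching_def)

lemma matching_insert:
  assumes "matching G M" "e \<in> edges G" "e \<inter> \<Union>M = {}"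
  shows "matching G (insert e M)"
  using assms unfolding matching_def pairwise_insert disjnt_def by blast

lemma matching_Diff: "matching G M \<Longrightarrow> matching G (M - A)"
  unfolding matching_def by (auto intro: pairwise_subset)

definition maximum_matching :: "'a ugraph \<Rightarrow> 'a set set \<Rightarrow> bool" where
  "maximum_matching G M \<longleftrightarrow> matching G M \<and> (\<forall>N. matching G N \<longrightarrow> card N \<le> card M)"

lemma maximum_matchingD:
  assumes "maximum_matching G M"
  shows "matching G M" and "matching G N \<Longrightarrow> card N \<le> card M"
  using assms by (auto simp: maximum_matching_def)

lemma max_matching_size_attained:
  assumes "simple_graph G"
  obtains M where "matching G M" "card M = max_matching_size G"
proof -
  have "max_matching_size G \<in> card ` {M. matching G M}"
    unfolding max_matching_size_def
    using finite_matchings[OF assms] matching_empty by (intro Max_in) blast+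
  then show ?thesis using that by auto
qed

lemma card_le_max_matching_size:
  "\<lbrakk>simple_graph G; matching G M\<rbrakk> \<Longrightarrow> card M \<le> max_matching_size G"
  unfolding max_matching_size_def using finite_matchings[of G] by (intro Max_ge) auto

lemma maximum_matching_exists:
  assumes "simple_graph G"
  obtains M where "maximum_matching G M"
  using max_matching_size_attained[OF assms] card_le_max_matching_size[OF assms]
  unfolding maximum_matching_def by metis

lemma twice_max_matching_size_le:
  assumes "simple_graph G"
  shows "2 * max_matching_size G \<le> graph_order G"
proof -
  obtain M where M: "matching G M" "card M = max_matching_size G"
    by (rule max_matching_size_attained[OF assms])
  have "card (\<Union>M) \<le> card (verts G)"
    using Union_matching_subset[OF assms M(1)] assms by (intro card_mono) (auto simp: simple_graph_def)
  then show ?thesis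
    using card_Union_matching[OF assms M(1)] M(2) by (simp add: graph_order_def)
qed

section \<open>Gallai's lemma and the Tutte--Berge bound\<close>

text \<open>This is transitivity of the relation ``no maximum matching misses both'' between vertices
  \<open>u\<close>, \<open>t\<close>, \<open>v\<close>. Among the maximum matchings missing \<open>t\<close>, one that shares the most edges with \<open>M\<close>
  could still be exchanged towards \<open>M\<close>.\<close>

lemma Gallai_lemma:
  assumes G: "simple_graph G"
    and M: "maximum_matching G M" "u \<notin> \<Union>M" "v \<notin> \<Union>M"
    and "u \<noteq> v"
    and t: "\<exists>N. maximum_matching G N \<and> t \<notin> \<Union>N"
    and cover: "\<And>N. maximum_matching G N \<Longrightarrow> t \<notin> \<Union>N \<Longrightarrow> u \<in> \<Union>N \<and> v \<in> \<Union>N"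
  shows False
proof -
  have finM: "finite M" using finite_matching G M(1) maximum_matchingD(1) by blast
  define Q where "Q N \<longleftrightarrow> maximum_matching G N \<and> t \<notin> \<Union>N" for N
  \<comment> \<open>A competitor sharing the most edges with \<open>M\<close> exists because
    overlaps stay below \<open>Suc (card M)\<close>.\<close>
  have "\<exists>N. Q N \<and> (\<forall>N'. Q N' \<longrightarrow> card (M \<inter> N') \<le> card (M \<inter> N))"
  proof -
    obtain N0 where "Q N0" using t Q_def by blast
    moreover have "\<forall>N. Q N \<longrightarrow> card (M \<inter> N) < Suc (card M)"
      using finM by (simp add: card_mono le_imp_less_Suc)
    ultimately show ?thesis
      using ex_has_greatest_nat[of Q N0 "\<lambda>N. card (M \<inter> N)" "Suc (card M)"] by blast
  qed
  then obtain N where N: "maximum_matching G N" "t \<notin> \<Union>N"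
    and best: "\<And>N'. maximum_matching G N' \<Longrightarrow> t \<notin> \<Union>N' \<Longrightarrow> card (M \<inter> N') \<le> card (M \<inter> N)"
    unfolding Q_def by blast
  note mM = maximum_matchingD(1)[OF M(1)] and mN = maximum_matchingD(1)[OF N(1)]
  have finN: "finite N" using finite_matching[OF G mN] .
  have finV: "finite (verts G)" using G by (simp add: simple_graph_def)
  have finU: "finite (\<Union>M)" "finite (\<Union>N)"
    using finV Union_matching_subset[OF G] mM mN finite_subset by blast+
  have "card M = card N"
    using maximum_matchingD(2)[OF M(1) mN] maximum_matchingD(2)[OF N(1) mM] by simp
  then have "card (\<Union>M) = card (\<Union>N)" using card_Union_matching[OF G] mM mN by simp
  \<comment> \<open>\<open>M\<close> and \<open>N\<close> cover equally many vertices, and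
    \<open>N\<close> covers \<open>u\<close> and \<open>v\<close>, which \<open>M\<close> misses. So
    \<open>M\<close> covers at least two vertices missed by \<open>N\<close>, one of them different
    from \<open>t\<close>.\<close>
  then have "card (\<Union>M - \<Union>N) = card (\<Union>N - \<Union>M)"
    using finU by (simp add: card_Diff_subset_Int Int_commute)
  moreover have "card {u, v} \<le> card (\<Union>N - \<Union>M)"
    using cover[OF N] M finU by (intro card_mono) auto
  ultimately have "card {t} < card (\<Union>M - \<Union>N)" using \<open>u \<noteq> v\<close> by simp
  then have "\<not> \<Union>M - \<Union>N \<subseteq> {t}" by (metis card_mono finite.emptyI finite.insertI leD)
  then obtain x e where x: "e \<in> M" "x \<in> e" "x \<notin> \<Union>N" "x \<noteq> t" by blast
  have e: "e \<in> edges G" "card e = 2" using x mM G by (auto simp: matching_def simple_graph_def)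
  then obtain y where y: "e = {x, y}" "x \<noteq> y"
    using x(2) by (auto simp: card_2_iff)
  have "e \<notin> N" using x by blast
  \<comment> \<open>Otherwise both ends of \<open>e\<close> would be free and \<open>e\<close> could
    be added to the maximum matching \<open>N\<close>.\<close>
  have "y \<in> \<Union>N"
  proof (rule ccontr)
    assume "y \<notin> \<Union>N"
    then have "matching G (insert e N)" using x y e by (intro matching_insert[OF mN]) auto
    then have "card (insert e N) \<le> card N" by (rule maximum_matchingD(2)[OF N(1)])
    then show False using \<open>e \<notin> N\<close> finN by simp
  qed
  then obtain f where f: "f \<in> N" "y \<in> f" by blast
  \<comment> \<open>The exchange: \<open>e\<close> replaces \<open>f\<close>, keeping the size and
    still missing \<open>t\<close>. It gains an edge of \<open>M\<close> and loses none, since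
    \<open>f\<close> meets \<open>e\<close> at \<open>y\<close> and so cannot lie in
    \<open>M\<close>; this contradicts the choice of \<open>N\<close>.\<close>
  define N' where "N' = insert e (N - {f})"
  have yN: "y \<notin> \<Union>(N - {f})"
    using f mN unfolding matching_def pairwise_def disjnt_def by blast
  have mN': "matching G N'"
    unfolding N'_def using x y e yN by (intro matching_insert matching_Diff mN) auto
  have "card N' = card N"
    unfolding N'_def using \<open>e \<notin> N\<close> finN card_Suc_Diff1[OF finN f(1)] by simp
  then have "maximum_matching G N'" using mN' N(1) by (simp add: maximum_matching_def)
  moreover have "t \<notin> \<Union>N'" unfolding N'_def using N(2) x y \<open>y \<in> \<Union>N\<close> by auto
  ultimately have le: "card (M \<inter> N') \<le> card (M \<inter> N)" by (rule best)
  have "f \<noteq> e" using f \<open>e \<notin> N\<close> by blast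
  then have "f \<notin> M"
    using pairwiseD[of disjnt M e f] mM x(1) f(2) y(1) by (auto simp: matching_def disjnt_def)
  then have "M \<inter> N' = insert e (M \<inter> N)" unfolding N'_def using x(1) by blast
  then have "card (M \<inter> N') = Suc (card (M \<inter> N))" using \<open>e \<notin> N\<close> finM by simp
  then show False using le by simp
qed

text \<open>The classes of the partition are encoded as the fibres of a map \<open>c\<close> on \<open>verts G - S\<close>.\<close>

lemma Tutte_Berge_bound:
  fixes G :: "'a ugraph"
  assumes "simple_graph G"
  shows "\<exists>S c M. S \<subseteq> verts G \<and> matching G M \<and>
    (\<forall>x y. {x, y} \<in> edges G \<longrightarrow> x \<notin> S \<longrightarrow> y \<notin> S \<longrightarrow> c x = (c y :: 'a set)) \<and>
    card (verts G) + card S \<le> card (c ` (verts G - S)) + 2 * card M"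
  using assms
proof (induction "card (verts G)" arbitrary: G rule: less_induct)
  case less
  note G = \<open>simple_graph G\<close>
  have finV: "finite (verts G)" using G by (simp add: simple_graph_def)
  show ?case
  proof (cases "\<exists>v\<in>verts G. \<forall>M. maximum_matching G M \<longrightarrow> v \<in> \<Union>M")
    case True
    then obtain v where v: "v \<in> verts G" "\<And>M. maximum_matching G M \<Longrightarrow> v \<in> \<Union>M" by blast
    define H where "H = (verts G - {v}, {e \<in> edges G. v \<notin> e})"
    have vH: "verts H = verts G - {v}" and eH: "edges H = {e \<in> edges G. v \<notin> e}"
      by (simp_all add: H_def verts_def edges_def)
    have H: "simple_graph H" using G by (auto simp: simple_graph_def vH eH)
    have card_vH: "card (verts G) = Suc (card (verts H))"
      unfolding vH using card_Suc_Diff1[OF finV v(1)] by simp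
    obtain S M and c :: "'a \<Rightarrow> 'a set" where S: "S \<subseteq> verts H" and M: "matching H M"
      and c: "\<And>x y. {x, y} \<in> edges H \<Longrightarrow> x \<notin> S \<Longrightarrow> y \<notin> S \<Longrightarrow> c x = c y"
      and le: "card (verts H) + card S \<le> card (c ` (verts H - S)) + 2 * card M"
      using less.hyps[OF _ H] card_vH by (metis lessI)
    \<comment> \<open>A matching of \<open>H\<close> misses \<open>v\<close>, so it is not maximum
      in \<open>G\<close>. The extra edge of \<open>M1\<close> adds 2 on the right of the bound,
      which pays for \<open>v\<close> being counted on the left both in \<open>verts G\<close> and
      in \<open>insert v S\<close>.\<close>
    have M': "matching G M" and "v \<notin> \<Union>M" using M by (auto simp: matching_def eH)
    then obtain M1 where M1: "matching G M1" "card M < card M1"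
      using v(2)[of M] unfolding maximum_matching_def by (meson not_le)
    have fS: "finite S" "v \<notin> S" using S finV finite_subset unfolding vH by blast+
    show ?thesis
    proof (intro exI conjI allI impI)
      show "insert v S \<subseteq> verts G" using S v vH by auto
      show "matching G M1" by fact
      show "c x = c y" if "{x, y} \<in> edges G" "x \<notin> insert v S" "y \<notin> insert v S" for x y
        using that c by (auto simp: eH)
      have "verts G - insert v S = verts H - S" unfolding vH by blast
      then show "card (verts G) + card (insert v S)
          \<le> card (c ` (verts G - insert v S)) + 2 * card M1"
        using le M1(2) card_vH fS by simp
    qed
  next
    case False
    then have missed: "\<exists>M. maximum_matching G M \<and> v \<notin> \<Union>M" if "v \<in> verts G" for v
      using that by blast
    \<comment> \<open>When every vertex is missed by some maximum matching, \<open>S = {}\<close>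
      works with the equivalence classes of \<open>R\<close>; transitivity is Gallai's
      lemma.\<close>
    define R where "R u v \<longleftrightarrow> u = v \<or> (\<forall>M. maximum_matching G M \<longrightarrow> u \<in> \<Union>M \<or> v \<in> \<Union>M)" for u v
    have Rsym: "R v u" if "R u v" for u v using that unfolding R_def by blast
    have Rtrans: "R u v" if "R u t" "R t v" "t \<in> verts G" for u t v
    proof (rule ccontr)
      assume "\<not> R u v"
      then obtain M where "u \<noteq> v" "maximum_matching G M" "u \<notin> \<Union>M" "v \<notin> \<Union>M"
        unfolding R_def by blast
      \<comment> \<open>If \<open>t\<close> were \<open>u\<close> or \<open>v\<close>, one of the
        two assumed relations would already be \<open>R u v\<close>.\<close>
      moreover from \<open>\<not> R u v\<close> have "t \<noteq> u" "t \<noteq> v" using that by blast+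
      then have "u \<in> \<Union>N \<and> v \<in> \<Union>N" if "maximum_matching G N" "t \<notin> \<Union>N" for N
        using that \<open>R u t\<close> \<open>R t v\<close> unfolding R_def by blast
      ultimately show False using Gallai_lemma[OF G] missed[OF \<open>t \<in> verts G\<close>] by metis
    qed
    define c where "c x = {z. R x z}" for x
    have c_eq: "c x = c y" if "R x y" "x \<in> verts G" "y \<in> verts G" for x y
      using that Rtrans Rsym unfolding c_def by blast
    obtain M where M: "maximum_matching G M" by (rule maximum_matching_exists[OF G])
    note mM = maximum_matchingD(1)[OF M]
    show ?thesis
    proof (intro exI conjI allI impI)
      show "{} \<subseteq> verts G" by simp
      show "matching G M" by fact
      fix x y assume xy: "{x, y} \<in> edges G"
      \<comment> \<open>An edge whose ends are both missed by a maximum matching would enlarge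
        it.\<close>
      have "R x y"
      proof (rule ccontr)
        assume "\<not> R x y"
        then obtain N where N: "maximum_matching G N" "x \<notin> \<Union>N" "y \<notin> \<Union>N"
          unfolding R_def by blast
        note mN = maximum_matchingD(1)[OF N(1)]
        have "matching G (insert {x, y} N)" using xy N by (intro matching_insert[OF mN]) auto
        then have "card (insert {x, y} N) \<le> card N" by (rule maximum_matchingD(2)[OF N(1)])
        moreover have "{x, y} \<notin> N" using N(2) by blast
        ultimately show False using finite_matching[OF G mN] by simp
      qed
      moreover have "x \<in> verts G" "y \<in> verts G" using xy G by (auto simp: simple_graph_def)
      ultimately show "c x = c y" by (rule c_eq)
    next
      \<comment> \<open>Two distinct vertices missed by the same maximum matching are unrelated, so
        the missed vertices lie in different classes and are no more numerous than the
        classes.\<close>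
      have inj: "inj_on c (verts G - \<Union>M)"
      proof (rule inj_onI)
        fix x y assume xy: "x \<in> verts G - \<Union>M" "y \<in> verts G - \<Union>M" "c x = c y"
        have "y \<in> c y" by (simp add: c_def R_def)
        then have "R x y" using xy(3) by (auto simp: c_def)
        then show "x = y" using xy M unfolding R_def by blast
      qed
      have sub: "\<Union>M \<subseteq> verts G" by (rule Union_matching_subset[OF G mM])
      have "card (verts G - \<Union>M) = card (c ` (verts G - \<Union>M))" using card_image[OF inj] by simp
      also have "\<dots> \<le> card (c ` verts G)" using finV by (intro card_mono) auto
      finally have "card (verts G) - card (\<Union>M) \<le> card (c ` verts G)"
        using sub finV by (simp add: card_Diff_subset finite_subset)
      then show "card (verts G) + card {} \<le> card (c ` (verts G - {})) + 2 * card M"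
        using card_Union_matching[OF G mM] by simp
    qed
  qed
qed

section \<open>Regular graphs\<close>

lemma card_neighbours_eq_degree:
  assumes "simple_graph G"
  shows "card {y. {x, y} \<in> edges G} = degree G x"
proof -
  have "bij_betw (\<lambda>y. {x, y}) {y. {x, y} \<in> edges G} {e \<in> edges G. x \<in> e}"
  proof (rule bij_betwI')
    show "({x, y} = {x, z}) = (y = z)" for y z by (auto simp: doubleton_eq_iff)
    fix e assume "e \<in> {e \<in> edges G. x \<in> e}"
    moreover from this have "card e = 2" using assms by (auto simp: simple_graph_def)
    ultimately show "\<exists>y\<in>{y. {x, y} \<in> edges G}. e = {x, y}"
      by (auto simp: card_2_iff insert_commute)
  qed auto
  then show ?thesis unfolding degree_def by (rule bij_betw_same_card)
qed

text \<open>This is the estimate that at most \<open>graph_order G / (d + 1)\<close> vertices are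
  missed, with denominators cleared. It holds because the Tutte--Berge set pays for all small
  classes, leaving only the few large ones.\<close>

lemma regular_matching_bound:
  fixes G :: "'a ugraph"
  assumes "regular_graph d G"
  shows "graph_order G * d \<le> 2 * (d + 1) * max_matching_size G"
proof -
  have G: "simple_graph G" and deg: "\<And>v. v \<in> verts G \<Longrightarrow> degree G v = d"
    using assms by (auto simp: regular_graph_def)
  have finV: "finite (verts G)" using G by (simp add: simple_graph_def)
  obtain S M and c :: "'a \<Rightarrow> 'a set" where S: "S \<subseteq> verts G" and M: "matching G M"
    and c: "\<And>x y. {x, y} \<in> edges G \<Longrightarrow> x \<notin> S \<Longrightarrow> y \<notin> S \<Longrightarrow> c x = c y"
    and le: "card (verts G) + card S \<le> card (c ` (verts G - S)) + 2 * card M"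
    using Tutte_Berge_bound[OF G] by blast
  define W where "W = verts G - S"
  define nb where "nb x = {y. {x, y} \<in> edges G}" for x
  define cl where "cl C = {x \<in> W. c x = C}" for C
  define small where "small = {C \<in> c ` W. card (cl C) \<le> d}"
  define large where "large = {C \<in> c ` W. d < card (cl C)}"
  have finW: "finite W" and finS: "finite S" using S finV finite_subset by (auto simp: W_def)
  have fin_cl: "finite (cl C)" for C using finW by (simp add: cl_def)
  have card_nb: "card (nb x) = d" if "x \<in> verts G" for x
    using card_neighbours_eq_degree[OF G] deg[OF that] by (simp add: nb_def)
  have nb_sub: "nb x \<subseteq> verts G - {x}" for x
    using G by (auto simp: nb_def simple_graph_def)
  have fin_nb: "finite (nb x)" for x using nb_sub finV finite_subset by blast
  have sum_classes: "sum f W = (\<Sum>C\<in>c ` W. sum f (cl C))" for f :: "'a \<Rightarrow> nat"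
    unfolding cl_def using sum.image_gen[OF finW, of f c] .
  have fin_sl: "finite small" "finite large" using finW by (auto simp: small_def large_def)
  have "card (c ` W) = card small + card large"
  proof -
    have "c ` W = small \<union> large" "small \<inter> large = {}" by (auto simp: small_def large_def)
    then show ?thesis using fin_sl by (simp add: card_Un_disjoint)
  qed
  moreover have "card small * d \<le> card S * d"
  proof -
    have to_S: "d \<le> (\<Sum>x\<in>cl C. card (nb x \<inter> S))" if "C \<in> small" for C
    proof -
      \<comment> \<open>The \<open>d\<close> neighbours of \<open>x\<close> lie in \<open>S\<close>
        or among the other members of its class, as no edge joins two classes.\<close>
      have each: "d + 1 - card (cl C) \<le> card (nb x \<inter> S)" if x: "x \<in> cl C" for x
      proof -
        have "x \<in> W" "c x = C" using x by (auto simp: cl_def)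
        then have "nb x \<subseteq> (nb x \<inter> S) \<union> (cl C - {x})"
          using nb_sub[of x] c[of x] by (auto simp: cl_def W_def nb_def)
        then have "card (nb x) \<le> card ((nb x \<inter> S) \<union> (cl C - {x}))"
          using fin_nb fin_cl by (intro card_mono) auto
        also have "\<dots> \<le> card (nb x \<inter> S) + card (cl C - {x})" by (rule card_Un_le)
        also have "card (cl C - {x}) = card (cl C) - 1" using x fin_cl by simp
        finally have "d \<le> card (nb x \<inter> S) + (card (cl C) - 1)"
          using card_nb[of x] \<open>x \<in> W\<close> by (simp add: W_def)
        moreover have "0 < card (cl C)" using x fin_cl card_gt_0_iff by blast
        ultimately show ?thesis by linarith
      qed
      have "cl C \<noteq> {}" and small_C: "card (cl C) \<le> d" using that by (auto simp: small_def cl_def)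
      then have "card (cl C) \<noteq> 0" using fin_cl by simp
      then obtain k where k: "card (cl C) = Suc k" by (cases "card (cl C)") auto
      then obtain m where m: "d = Suc k + m" using small_C le_Suc_ex by metis
      \<comment> \<open>The product is \<open>(k + 1) * (m + 1)\<close>, which exceeds
        \<open>d = k + 1 + m\<close> by \<open>k * m\<close>.\<close>
      have "d \<le> card (cl C) * (d + 1 - card (cl C))" unfolding k m by simp
      also have "\<dots> \<le> (\<Sum>x\<in>cl C. card (nb x \<inter> S))"
        using sum_bounded_below[of "cl C", OF each] by simp
      finally show ?thesis .
    qed
    have "card small * d \<le> (\<Sum>C\<in>small. \<Sum>x\<in>cl C. card (nb x \<inter> S))"
      using sum_bounded_below[of small, OF to_S] by simp
    also have "\<dots> \<le> (\<Sum>C\<in>c ` W. \<Sum>x\<in>cl C. card (nb x \<inter> S))"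
      using finW by (intro sum_mono2) (auto simp: small_def)
    \<comment> \<open>Double counting of the edges between \<open>W\<close> and \<open>S\<close>;
      seen from \<open>S\<close>, each vertex contributes at most its degree
      \<open>d\<close>.\<close>
    also have "\<dots> = (\<Sum>x\<in>W. card {s \<in> S. {x, s} \<in> edges G})"
      unfolding sum_classes[symmetric] by (simp add: nb_def Int_def conj_commute)
    also have "\<dots> = (\<Sum>s\<in>S. card {x \<in> W. {x, s} \<in> edges G})"
      using finW finS by (intro sum_multicount_gen) auto
    also have "\<dots> \<le> (\<Sum>s\<in>S. d)"
    proof (rule sum_mono)
      fix s assume "s \<in> S"
      then have "card (nb s) = d" using S card_nb by blast
      moreover have "{x \<in> W. {x, s} \<in> edges G} \<subseteq> nb s" by (auto simp: nb_def insert_commute)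
      ultimately show "card {x \<in> W. {x, s} \<in> edges G} \<le> d" using fin_nb card_mono by metis
    qed
    finally show ?thesis by simp
  qed
  moreover have "card large * (d + 1) \<le> card (verts G)"
  proof -
    have "card large * (d + 1) \<le> (\<Sum>C\<in>large. card (cl C))"
      using sum_bounded_below[of large "d + 1" "\<lambda>C. card (cl C)"] by (simp add: large_def)
    also have "\<dots> \<le> (\<Sum>C\<in>c ` W. card (cl C))"
      using finW by (intro sum_mono2) (auto simp: large_def)
    also have "\<dots> = card W" using sum_classes[of "\<lambda>_. 1"] by simp
    also have "\<dots> \<le> card (verts G)" using finV by (intro card_mono) (auto simp: W_def)
    finally show ?thesis .
  qed
  moreover have "card M \<le> max_matching_size G" by (rule card_le_max_matching_size[OF G M])
  ultimately show ?thesis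
  proof (cases "d = 0")
    \<comment> \<open>A positive \<open>d\<close> cancels from the inequality for
      \<open>small\<close>. After multiplying by \<open>d + 1\<close>, the large classes account for
      at most \<open>card (verts G)\<close>.\<close>
    case False
    assume *: "card (c ` W) = card small + card large" "card small * d \<le> card S * d"
      "card large * (d + 1) \<le> card (verts G)" "card M \<le> max_matching_size G"
    have "card small \<le> card S" using *(2) False by simp
    then have "card (verts G) \<le> card large + 2 * max_matching_size G"
      using le *(1,4) unfolding W_def by linarith
    then have "card (verts G) * (d + 1) \<le> (card large + 2 * max_matching_size G) * (d + 1)"
      by (rule mult_right_mono) simp
    then show ?thesis using *(3) by (simp add: graph_order_def algebra_simps)
  qed simp
qed

section \<open>Asymptotics along the admissible orders\<close>

lemma degree_tendsto_infinity:
  fixes d :: "nat \<Rightarrow> nat"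
  assumes "filterlim (\<lambda>n. real (d n) / ln (real n)) at_top sequentially"
  shows "filterlim (\<lambda>n. real (d n)) at_top sequentially"
proof (rule filterlim_at_top_mono[OF assms])
  \<comment> \<open>From 3 on, \<open>n\<close> is at least \<open>exp 1\<close>, so dividing by
    \<open>ln (real n)\<close> does not increase \<open>d n\<close>.\<close>
  show "\<forall>\<^sub>F n in sequentially. real (d n) / ln (real n) \<le> real (d n)"
    using eventually_ge_at_top[of 3]
  proof eventually_elim
    case (elim n)
    then have "exp 1 \<le> real n" using exp_le by linarith
    then have "1 \<le> ln (real n)" using elim by (simp add: ln_ge_iff)
    then show ?case by (simp add: divide_le_eq mult_le_cancel_left1)
  qed
qed

theorem theorem1p3:
  fixes d :: "nat \<Rightarrow> nat" and G :: "nat \<Rightarrow> 'a ugraph"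
  assumes "\<And>n. 0 < n \<Longrightarrow> 0 < d n"
    and "filterlim (\<lambda>n. real (d n) / ln (real n)) at_top sequentially"
    and "\<And>n. n \<in> admissible d \<Longrightarrow> regular_graph (d n) (G n) \<and> graph_order (G n) = n"
  shows "\<exists>\<epsilon> :: nat \<Rightarrow> real.
           (\<epsilon> \<longlongrightarrow> 0) (inf sequentially (principal (admissible d))) \<and>
           (\<forall>n\<in>admissible d. real (max_matching_size (G n)) = (1 / 2 - \<epsilon> n) * real n)"
proof (intro exI conjI ballI)
  \<comment> \<open>Half the proportion of vertices missed by a maximum matching.\<close>
  define \<epsilon> where "\<epsilon> n = 1 / 2 - real (max_matching_size (G n)) / real n" for n
  let ?F = "inf sequentially (principal (admissible d))"
  have bounds: "0 \<le> \<epsilon> n \<and> \<epsilon> n \<le> inverse (real (d n))" if n: "n \<in> admissible d" for n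
  proof -
    let ?m = "real (max_matching_size (G n))"
    have reg: "regular_graph (d n) (G n)" "graph_order (G n) = n" using assms(3)[OF n] by auto
    have "0 < n" using n by (simp add: admissible_def)
    then have "0 < d n" by (rule assms(1))
    have "2 * max_matching_size (G n) \<le> n"
      using twice_max_matching_size_le[of "G n"] reg by (simp add: regular_graph_def)
    then have upper: "2 * ?m \<le> real n" by linarith
    have "real (n * d n) \<le> real (2 * (d n + 1) * max_matching_size (G n))"
      using regular_matching_bound[OF reg(1)] reg(2) by (metis of_nat_le_iff)
    then have lower: "real n * real (d n) \<le> 2 * ?m + 2 * ?m * real (d n)"
      by (simp add: algebra_simps)
    \<comment> \<open>The generous \<open>2 * real n\<close> in place of \<open>2 * ?m\<close> makes
      division by \<open>2 * real n * real (d n)\<close> yield exactly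
      \<open>inverse (real (d n))\<close>.\<close>
    have "real n * real (d n) \<le> 2 * real n + 2 * ?m * real (d n)"
      using lower upper by linarith
    then have "\<epsilon> n \<le> inverse (real (d n))"
      using \<open>0 < n\<close> \<open>0 < d n\<close> by (simp add: \<epsilon>_def field_simps)
    moreover have "0 \<le> \<epsilon> n" using upper \<open>0 < n\<close> by (simp add: \<epsilon>_def field_simps)
    ultimately show ?thesis by blast
  qed
  have in_adm: "\<forall>\<^sub>F n in ?F. n \<in> admissible d"
    by (simp add: eventually_inf_principal)
  have "((\<lambda>n. inverse (real (d n))) \<longlongrightarrow> 0) sequentially"
    by (rule tendsto_inverse_0_at_top[OF degree_tendsto_infinity[OF assms(2)]])
  then have lim: "((\<lambda>n. inverse (real (d n))) \<longlongrightarrow> 0) ?F"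
    by (rule tendsto_mono[rotated]) simp
  show "(\<epsilon> \<longlongrightarrow> 0) ?F"
  proof (rule tendsto_sandwich[OF _ _ tendsto_const lim])
    show "\<forall>\<^sub>F n in ?F. 0 \<le> \<epsilon> n"
      using in_adm by eventually_elim (use bounds in blast)
    show "\<forall>\<^sub>F n in ?F. \<epsilon> n \<le> inverse (real (d n))"
      using in_adm by eventually_elim (use bounds in blast)
  qed
  fix n assume "n \<in> admissible d"
  then show "real (max_matching_size (G n)) = (1 / 2 - \<epsilon> n) * real n"
    by (simp add: \<epsilon>_def admissible_def)
qed

end
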